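(* Let $\mathcal{F}$ be a continuous-time, uncertain, piecewise linear dynamical system on $\mathbb{R}^d$ with nonempty finite mode set $Q$, matrices $(A_q)_{q\in Q}$, and regions $H_q=\mathbb{R}^d$ for all $q\in Q$. Let $\epsilon\ge1$ and $\gamma>0$. Let $V(x)=\max_{c\in\mathcal{V}}c^\top x$ be a polyhedral potential Lyapunov function with eccentricity $\epsilon$. Assume that $V$ is a Lyapunov function for any $\gamma$-perturbation of System $\mathcal{F}$. Then, for any $(\theta,\delta)$ satisfying $0<\theta\le\frac{\gamma}{2a_{\max}(\epsilon+\gamma)}$ and $0<\delta\le\frac{\gamma a_{\max}}{2\epsilon}$, it holds that for all $x\in\mathbb{R}^d$, $v\in\mathcal{F}(x)$ and $c\in\mathcal{V}$, $$c^\top v\le\frac1\theta\bigl(V(x)-c^\top x\bigr)-\delta\,\mathcal{V}_{\max}\|x\|.$$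
   Context: $\|\cdot\|$ is a vector norm on $\mathbb{R}^d$ ($d\ge1$), with dual norm $\|c\|_*=\max\{c^\top x:\|x\|=1\}$ and induced matrix norm $\|A\|=\max\{\|Ax\|:\|x\|=1\}$. A continuous-time, uncertain, piecewise linear dynamical system is given by a finite set of modes $Q$ and, for each $q\in Q$, a closed polyhedral conic region $H_q\subseteq\mathbb{R}^d$ and a matrix $A_q\in\mathbb{R}^{d\times d}$. It is identified with the set-valued map $\mathcal{F}(x)=\{A_qx: q\in Q,\ x\in H_q\}$. Here $a_{\max}=\max_{q\in Q}\|A_q\|$. A $\gamma$-perturbation of $\mathcal{F}$ (when all $H_q=\mathbb{R}^d$) is a system of the same type with the same mode set $Q$, regions $H'_q=\mathbb{R}^d$ for all $q$, and matrices $A'_q$ satisfying $\|A'_q-A_q\|\le\gamma a_{\max}$ for all $q\in Q$. A polyhedral function is a function $V(x)=\max_{c\in\mathcal{V}}c^\top x$ for a finite set $\mathcal{V}\subseteq\mathbb{R}^d$; a defining set $\mathcal{V}$ is fixed together with $V$, and $\mathcal{V}_{\max}=\max_{c\in\mathcal{V}}\|c\|_*$. The upper-right Dini derivative is $D^+f(x;v)=\limsup_{s\to0^+}\frac{f(x+sv)-f(x)}{s}$. A continuous $V:\mathbb{R}^d\to\mathbb{R}_{\ge0}$ is a potential Lyapunov function if $V(x)=0$ iff $x=0$ and $V$ is radially unbounded ($\lim_{r\to\infty}\inf\{V(x):\|x\|\ge r\}=\infty$); it is a Lyapunov function for a system $\mathcal{G}$ if moreover $D^+V(x;v)<0$ for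 all $x\ne0$ and $v\in\mathcal{G}(x)$. $V$ has eccentricity $\epsilon$ if $\dfrac{\max\{\|x\|:V(x)=1\}}{\min\{\|x\|:V(x)=1\}}\le\epsilon$. *)

theory Defs
  imports "HOL-Analysis.Analysis"
begin

text \<open>
  An arbitrary vector norm on \<open>\<real>\<^sup>d\<close> is a function \<open>N\<close> on \<open>real ^ 'd\<close>, unrelated to the
  Euclidean \<open>norm\<close> of the library. The suprema in \<open>dual_norm\<close> and \<open>mat_norm\<close> are
  maxima, since \<open>{x. N x = 1}\<close> is nonempty and compact.
\<close>

definition vector_norm :: "(real ^ 'd \<Rightarrow> real) \<Rightarrow> bool" where
  "vector_norm N \<longleftrightarrow>
     (\<forall>x. 0 \<le> N x) \<and> (\<forall>x. N x = 0 \<longleftrightarrow> x = 0) \<and>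
     (\<forall>r x. N (r *\<^sub>R x) = \<bar>r\<bar> * N x) \<and> (\<forall>x y. N (x + y) \<le> N x + N y)"

definition dual_norm :: "(real ^ 'd \<Rightarrow> real) \<Rightarrow> real ^ 'd \<Rightarrow> real" where
  "dual_norm N c = (SUP x\<in>{x. N x = 1}. c \<bullet> x)"

definition mat_norm :: "(real ^ 'd \<Rightarrow> real) \<Rightarrow> real ^ 'd ^ 'd \<Rightarrow> real" where
  "mat_norm N A = (SUP x\<in>{x. N x = 1}. N (A *v x))"

record ('q, 'd) pwl_system =
  modes :: "'q set"
  region :: "'q \<Rightarrow> (real ^ 'd) set"
  mode_matrix :: "'q \<Rightarrow> real ^ 'd ^ 'd"

text \<open>Closedness of the regions is part of \<open>polyhedron\<close>.\<close>

definition is_pwl_system :: "('q, 'd::finite) pwl_system \<Rightarrow> bool" where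
  "is_pwl_system F \<longleftrightarrow> finite (modes F) \<and>
     (\<forall>q\<in>modes F. polyhedron (region F q) \<and> cone (region F q) \<and> region F q \<noteq> {})"

definition sys_map :: "('q, 'd::finite) pwl_system \<Rightarrow> real ^ 'd \<Rightarrow> (real ^ 'd) set" where
  "sys_map F x = {mode_matrix F q *v x | q. q \<in> modes F \<and> x \<in> region F q}"

definition a_max :: "(real ^ 'd::finite \<Rightarrow> real) \<Rightarrow> ('q, 'd) pwl_system \<Rightarrow> real" where
  "a_max N F = Max ((\<lambda>q. mat_norm N (mode_matrix F q)) ` modes F)"

text \<open>Only meant for systems \<open>F\<close> all of whose regions are the whole space.\<close>

definition is_perturbation ::
  "(real ^ 'd::finite \<Rightarrow> real) \<Rightarrow> real \<Rightarrow> ('q, 'd) pwl_system \<Rightarrow> ('q, 'd) pwl_system \<Rightarrow> bool" where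
  "is_perturbation N \<gamma> F G \<longleftrightarrow> is_pwl_system G \<and> modes G = modes F \<and>
     (\<forall>q\<in>modes F. region G q = UNIV) \<and>
     (\<forall>q\<in>modes F. mat_norm N (mode_matrix G q - mode_matrix F q) \<le> \<gamma> * a_max N F)"

definition defines_polyhedral_fun :: "(real ^ 'd) set \<Rightarrow> (real ^ 'd \<Rightarrow> real) \<Rightarrow> bool" where
  "defines_polyhedral_fun C V \<longleftrightarrow>
     finite C \<and> C \<noteq> {} \<and> (\<forall>x. V x = Max ((\<lambda>c. c \<bullet> x) ` C))"

definition max_dual_norm :: "(real ^ 'd \<Rightarrow> real) \<Rightarrow> (real ^ 'd) set \<Rightarrow> real" where
  "max_dual_norm N C = Max (dual_norm N ` C)"

definition dini_upper_right :: "(real ^ 'd \<Rightarrow> real) \<Rightarrow> real ^ 'd \<Rightarrow> real ^ 'd \<Rightarrow> ereal" where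
  "dini_upper_right f x v =
     Limsup (at_right 0) (\<lambda>s. ereal ((f (x + s *\<^sub>R v) - f x) / s))"

definition potential_lyapunov :: "(real ^ 'd \<Rightarrow> real) \<Rightarrow> (real ^ 'd \<Rightarrow> real) \<Rightarrow> bool" where
  "potential_lyapunov N V \<longleftrightarrow>
     continuous_on UNIV V \<and> (\<forall>x. 0 \<le> V x) \<and> (\<forall>x. V x = 0 \<longleftrightarrow> x = 0) \<and>
     filterlim (\<lambda>r. INF x\<in>{x. r \<le> N x}. V x) at_top at_top"

definition lyapunov ::
  "(real ^ 'd::finite \<Rightarrow> real) \<Rightarrow> ('q, 'd) pwl_system \<Rightarrow> (real ^ 'd \<Rightarrow> real) \<Rightarrow> bool" where
  "lyapunov N G V \<longleftrightarrow> potential_lyapunov N V \<and>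
     (\<forall>x v. x \<noteq> 0 \<longrightarrow> v \<in> sys_map G x \<longrightarrow> dini_upper_right V x v < 0)"

text \<open>
  For a positively homogeneous potential Lyapunov function, the level set \<open>{x. V x = 1}\<close> is
  nonempty and compact, so the supremum and infimum are a maximum and a positive minimum.
\<close>

definition has_eccentricity ::
  "(real ^ 'd \<Rightarrow> real) \<Rightarrow> (real ^ 'd \<Rightarrow> real) \<Rightarrow> real \<Rightarrow> bool" where
  "has_eccentricity N V \<epsilon> \<longleftrightarrow> (SUP x\<in>{x. V x = 1}. N x) / (INF x\<in>{x. V x = 1}. N x) \<le> \<epsilon>"

end

theory Submission
  imports Defs
begin

text \<open>
  Write \<open>a\<close> for the largest mode norm, \<open>M\<close> for the largest dual norm of a vector of \<open>C\<close>, and let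
  \<open>A\<close> be a mode matrix. For \<open>y = x + \<theta> A x\<close>, the assertion for all \<open>c\<close> in \<open>C\<close> at once is equivalent
  to the decrease of \<open>V\<close> along one explicit Euler step of length \<open>\<theta>\<close>:
  \<open>V y \<le> V x - \<theta> \<delta> M N x\<close>.

  To prove the decrease, shift every mode by \<open>\<gamma> a\<close> times the identity, which is an admissible
  perturbation. If \<open>c\<close> attains the maximum \<open>V z\<close> at \<open>z \<noteq> 0\<close>, then \<open>c\<close> bounds the Dini derivative at
  \<open>z\<close> from below, and the Lyapunov property of the shifted system reads \<open>c \<bullet> A z < - \<gamma> a V z\<close>
  (\<open>active_vector_decay\<close>). The eccentricity bounds the right-hand side from above by
  \<open>- \<gamma> a M N z / \<epsilon>\<close> (\<open>eccentricity_lower_bound\<close>).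

  The idea is to use this at the end point \<open>y\<close> of the Euler step, not at its starting point. With
  \<open>c\<close> active at \<open>y\<close> and \<open>A x = A y - \<theta> A (A x)\<close>, the derivative \<open>c \<bullet> A x\<close> differs from \<open>c \<bullet> A y\<close> by
  at most \<open>\<theta> M a\<^sup>2 N x\<close>, while \<open>N y \<ge> (1 - \<theta> a) N x\<close>. The bound on \<open>\<theta>\<close> is what lets these two losses
  consume only half of the decay rate, so \<open>c \<bullet> A x \<le> - \<gamma> a M N x / (2 \<epsilon>) \<le> - \<delta> M N x\<close>. Since \<open>c\<close> is
  active at \<open>y\<close>, \<open>V x \<ge> c \<bullet> x = V y - \<theta> (c \<bullet> A x)\<close>, and the decrease follows.
\<close>

section \<open>Vector norms and their dual and matrix norms\<close>

lemma vector_norm_simps: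
  assumes "vector_norm N"
  shows "0 \<le> N x" "N x = 0 \<longleftrightarrow> x = 0" "N (r *\<^sub>R x) = \<bar>r\<bar> * N x" "N (x + y) \<le> N x + N y"
    and "N 0 = 0" "N (- x) = N x"
proof -
  show "N (- x) = N x"
    using assms unfolding vector_norm_def
    by (metis abs_minus_cancel abs_one mult_1 scaleR_minus1_left)
qed (use assms in \<open>auto simp: vector_norm_def\<close>)

lemma vector_norm_continuous:
  fixes N :: "real ^ 'd::finite \<Rightarrow> real"
  assumes N: "vector_norm N"
  shows "continuous_on S N"
proof -
  have "convex_on UNIV N"
  proof (rule convex_onI)
    fix t :: real and x y :: "real ^ 'd"
    assume t: "0 < t" "t < 1"
    have "N ((1 - t) *\<^sub>R x + t *\<^sub>R y) \<le> N ((1 - t) *\<^sub>R x) + N (t *\<^sub>R y)"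
      by (rule vector_norm_simps[OF N])
    then show "N ((1 - t) *\<^sub>R x + t *\<^sub>R y) \<le> (1 - t) * N x + t * N y"
      using t by (simp add: vector_norm_simps[OF N])
  qed simp
  then have "continuous_on UNIV N"
    by (intro convex_on_continuous) auto
  then show ?thesis
    using continuous_on_subset by blast
qed

text \<open>
  By homogeneity it suffices to bound \<open>N\<close> from below by a positive constant on the Euclidean unit
  sphere, where it attains a positive minimum by compactness.
\<close>

lemma norm_le_vector_norm:
  fixes N :: "real ^ 'd::finite \<Rightarrow> real"
  assumes N: "vector_norm N"
  obtains K where "0 < K" "\<And>x. norm x \<le> K * N x"
proof -
  have ne: "sphere (0 :: real ^ 'd) 1 \<noteq> {}"
    by (simp add: sphere_eq_empty)
  obtain u :: "real ^ 'd" where u: "norm u = 1" and min: "\<And>x. norm x = 1 \<Longrightarrow> N u \<le> N x"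
    using continuous_attains_inf[OF compact_sphere ne vector_norm_continuous[OF N]] by auto
  have pos: "0 < N u"
    using u vector_norm_simps(1,2)[OF N, of u] by (cases "u = 0") auto
  have "norm x \<le> (1 / N u) * N x" for x
  proof (cases "x = 0")
    case False
    have "N u \<le> N ((1 / norm x) *\<^sub>R x)"
      by (rule min) (use False in simp)
    then show ?thesis
      using False pos by (simp add: vector_norm_simps[OF N] field_simps)
  qed (simp add: vector_norm_simps[OF N])
  then show ?thesis
    using that[of "1 / N u"] pos by auto
qed

lemma unit_sphere_compact:
  fixes N :: "real ^ 'd::finite \<Rightarrow> real"
  assumes N: "vector_norm N"
  shows "compact {x. N x = 1}"
proof -
  obtain K where K: "\<And>x. norm x \<le> K * N x"
    using norm_le_vector_norm[OF N] by blast
  have "bounded {x. N x = 1}"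
    by (rule boundedI[of _ K]) (use K in \<open>metis mem_Collect_eq mult.right_neutral\<close>)
  moreover have "closed {x. N x = 1}"
    using continuous_closed_preimage[OF vector_norm_continuous[OF N] closed_UNIV closed_singleton]
    by (simp add: vimage_def)
  ultimately show ?thesis
    by (simp add: compact_eq_bounded_closed)
qed

lemma unit_sphere_nonempty:
  fixes N :: "real ^ 'd::finite \<Rightarrow> real"
  assumes N: "vector_norm N"
  shows "{x. N x = 1} \<noteq> {}"
proof -
  obtain x :: "real ^ 'd" where "x \<noteq> 0"
    by (metis zero_neq_one)
  then have "N ((1 / N x) *\<^sub>R x) = 1"
    by (simp add: vector_norm_simps[OF N])
  then show ?thesis
    by blast
qed

text \<open>
  The suprema that define the dual norm and the matrix norm are real-valued and therefore bound
  their members only once the continuous image of the compact unit sphere is known to be bounded.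
\<close>

lemma inner_le_dual_norm:
  fixes N :: "real ^ 'd::finite \<Rightarrow> real"
  assumes N: "vector_norm N"
  shows "c \<bullet> x \<le> dual_norm N c * N x"
proof (cases "x = 0")
  case False
  then have pos: "0 < N x"
    using vector_norm_simps(1,2)[OF N, of x] by linarith
  have "bounded ((\<lambda>x. c \<bullet> x) ` {x. N x = 1})"
    by (intro compact_imp_bounded compact_continuous_image continuous_intros
        unit_sphere_compact[OF N])
  then have "c \<bullet> ((1 / N x) *\<^sub>R x) \<le> dual_norm N c"
    unfolding dual_norm_def
    by (intro cSUP_upper bounded_imp_bdd_above)
      (use False pos in \<open>auto simp: vector_norm_simps[OF N]\<close>)
  then show ?thesis
    using pos by (simp add: field_simps)
qed (simp add: vector_norm_simps[OF N])

lemma vector_norm_mult_le_mat_norm: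
  fixes N :: "real ^ 'd::finite \<Rightarrow> real"
  assumes N: "vector_norm N"
  shows "N (A *v x) \<le> mat_norm N A * N x"
proof (cases "x = 0")
  case False
  then have pos: "0 < N x"
    using vector_norm_simps(1,2)[OF N, of x] by linarith
  have "continuous_on {x. N x = 1} (N \<circ> (*v) A)"
    by (intro continuous_on_compose vector_norm_continuous[OF N] matrix_vector_mult_linear_continuous_on)
  then have "bounded ((N \<circ> (*v) A) ` {x. N x = 1})"
    by (intro compact_imp_bounded compact_continuous_image unit_sphere_compact[OF N])
  then have "N (A *v ((1 / N x) *\<^sub>R x)) \<le> mat_norm N A"
    unfolding mat_norm_def
    by (intro cSUP_upper bounded_imp_bdd_above)
      (use False pos in \<open>auto simp: vector_norm_simps[OF N] o_def\<close>)
  then show ?thesis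
    using pos by (simp add: vector_norm_simps[OF N] matrix_vector_mult_scaleR field_simps)
qed (simp add: vector_norm_simps[OF N])

lemma mat_norm_scaled_identity:
  fixes N :: "real ^ 'd::finite \<Rightarrow> real"
  assumes N: "vector_norm N"
  shows "mat_norm N (r *\<^sub>R mat 1) = \<bar>r\<bar>"
proof -
  have "N ((r *\<^sub>R mat 1) *v x) = \<bar>r\<bar>" if "N x = 1" for x
    using that by (simp add: scaleR_matrix_vector_assoc[symmetric] vector_norm_simps[OF N])
  then show ?thesis
    unfolding mat_norm_def using unit_sphere_nonempty[OF N] by simp
qed

section \<open>Polyhedral functions\<close>

lemma polyhedral_fun_upper:
  assumes "defines_polyhedral_fun C V" "c \<in> C"
  shows "c \<bullet> x \<le> V x"
  using assms unfolding defines_polyhedral_fun_def by simp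

lemma polyhedral_fun_active:
  assumes "defines_polyhedral_fun C V"
  obtains c where "c \<in> C" "c \<bullet> x = V x"
proof -
  have "Max ((\<lambda>c. c \<bullet> x) ` C) \<in> (\<lambda>c. c \<bullet> x) ` C"
    using assms unfolding defines_polyhedral_fun_def by (intro Max_in) auto
  then show ?thesis
    using assms that unfolding defines_polyhedral_fun_def by (metis (no_types, lifting) imageE)
qed

lemma polyhedral_fun_scaleR:
  assumes V: "defines_polyhedral_fun C V" and "0 \<le> t"
  shows "V (t *\<^sub>R x) = t * V x"
proof (rule antisym)
  obtain c where "c \<in> C" "c \<bullet> (t *\<^sub>R x) = V (t *\<^sub>R x)"
    using polyhedral_fun_active[OF V] by blast
  then show "V (t *\<^sub>R x) \<le> t * V x"
    using polyhedral_fun_upper[OF V, of c x] \<open>0 \<le> t\<close> by (metis inner_scaleR_right mult_left_mono)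
next
  obtain c where "c \<in> C" "c \<bullet> x = V x"
    using polyhedral_fun_active[OF V] by blast
  then show "t * V x \<le> V (t *\<^sub>R x)"
    using polyhedral_fun_upper[OF V, of c "t *\<^sub>R x"] by simp
qed

lemma inner_le_max_dual_norm:
  fixes N :: "real ^ 'd::finite \<Rightarrow> real"
  assumes N: "vector_norm N" and V: "defines_polyhedral_fun C V" and c: "c \<in> C"
  shows "c \<bullet> x \<le> max_dual_norm N C * N x"
proof -
  have "dual_norm N c \<le> max_dual_norm N C"
    unfolding max_dual_norm_def using V c by (simp add: defines_polyhedral_fun_def)
  then show ?thesis
    using inner_le_dual_norm[OF N, of c x] mult_right_mono[OF _ vector_norm_simps(1)[OF N]]
    by (meson order_trans)
qed

lemma polyhedral_fun_le_max_dual_norm: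
  fixes N :: "real ^ 'd::finite \<Rightarrow> real"
  assumes "vector_norm N" "defines_polyhedral_fun C V"
  shows "V x \<le> max_dual_norm N C * N x"
  using polyhedral_fun_active[OF assms(2)] inner_le_max_dual_norm[OF assms] by metis

lemma max_dual_norm_le:
  fixes N :: "real ^ 'd::finite \<Rightarrow> real"
  assumes N: "vector_norm N" and V: "defines_polyhedral_fun C V"
    and bound: "\<And>x. N x = 1 \<Longrightarrow> V x \<le> b"
  shows "max_dual_norm N C \<le> b"
proof -
  have "dual_norm N c \<le> b" if "c \<in> C" for c
    unfolding dual_norm_def
    by (intro cSUP_least unit_sphere_nonempty[OF N])
      (use polyhedral_fun_upper[OF V that] bound order_trans in blast)
  then show ?thesis
    using V unfolding max_dual_norm_def defines_polyhedral_fun_def by simp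
qed

lemma sublevel_set_bounded:
  assumes V: "potential_lyapunov N V"
  obtains r where "\<And>x. V x \<le> b \<Longrightarrow> N x < r"
proof -
  have "eventually (\<lambda>r. b < (INF x\<in>{x. r \<le> N x}. V x)) at_top"
    using V unfolding potential_lyapunov_def filterlim_at_top_dense by blast
  then obtain r where r: "b < (INF x\<in>{x. r \<le> N x}. V x)"
    by (meson eventually_at_top_linorder order_refl)
  have "N x < r" if "V x \<le> b" for x
  proof (rule ccontr)
    assume "\<not> N x < r"
    moreover have "bdd_below (V ` {x. r \<le> N x})"
      using V unfolding potential_lyapunov_def by (intro bdd_belowI[of _ 0]) auto
    ultimately have "(INF x\<in>{x. r \<le> N x}. V x) \<le> V x"
      by (intro cINF_lower) auto
    then show False
      using r that by linarith
  qed
  then show ?thesis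
    using that by blast
qed

text \<open>
  With \<open>s\<close> and \<open>R\<close> the extreme values of \<open>N\<close> on the level set \<open>V = 1\<close>, homogeneity gives
  \<open>N x \<le> R V x\<close> and \<open>s V x \<le> N x\<close>. The second inequality on the unit sphere of \<open>N\<close> bounds the
  maximal dual norm by \<open>1 / s\<close>, and the eccentricity says \<open>R \<le> \<epsilon> s\<close>.
\<close>

lemma eccentricity_lower_bound:
  fixes N :: "real ^ 'd::finite \<Rightarrow> real"
  assumes N: "vector_norm N" and V: "defines_polyhedral_fun C V"
    and P: "potential_lyapunov N V" and E: "has_eccentricity N V \<epsilon>"
  shows "max_dual_norm N C * N x \<le> \<epsilon> * V x"
proof -
  define M where "M = max_dual_norm N C"
  define R where "R = (SUP x\<in>{x. V x = 1}. N x)"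
  define s where "s = (INF x\<in>{x. V x = 1}. N x)"
  have Vpos: "0 < V x" if "x \<noteq> 0" for x
    using P that unfolding potential_lyapunov_def by (metis less_eq_real_def)
  have V0: "V 0 = 0"
    using P unfolding potential_lyapunov_def by blast
  have normalized: "V ((1 / V x) *\<^sub>R x) = 1" "N ((1 / V x) *\<^sub>R x) = N x / V x" if "x \<noteq> 0" for x
    using Vpos[OF that] by (simp_all add: polyhedral_fun_scaleR[OF V] vector_norm_simps[OF N])
  obtain u where u: "N u = 1"
    using unit_sphere_nonempty[OF N] by blast
  then have u0: "u \<noteq> 0"
    using vector_norm_simps(2)[OF N, of u] by auto
  have M: "0 < M"
    using Vpos[OF u0] polyhedral_fun_le_max_dual_norm[OF N V, of u] u by (simp add: M_def)
  have lower: "1 / M \<le> N x" if "V x = 1" for x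
    using polyhedral_fun_le_max_dual_norm[OF N V, of x] that M by (simp add: M_def field_simps)
  have "1 / M \<le> s"
    unfolding s_def by (rule cINF_greatest) (use normalized(1)[OF u0] lower in auto)
  then have s: "0 < s"
    using M by (meson divide_pos_pos less_le_trans zero_less_one)
  obtain r where r: "\<And>x. V x \<le> 1 \<Longrightarrow> N x < r"
    using sublevel_set_bounded[OF P] by blast
  have upper: "N x \<le> R * V x" for x
  proof (cases "x = 0")
    case False
    have "bdd_above (N ` {x. V x = 1})"
      using r by (intro bdd_aboveI[of _ r]) (auto simp: less_imp_le)
    then have "N ((1 / V x) *\<^sub>R x) \<le> R"
      unfolding R_def by (intro cSUP_upper) (use normalized[OF False] in auto)
    then show ?thesis
      using Vpos[OF False] normalized(2)[OF False] by (simp add: field_simps)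
  qed (simp add: V0 vector_norm_simps[OF N])
  have "V x \<le> 1 / s" if "N x = 1" for x
  proof -
    have x: "x \<noteq> 0"
      using that vector_norm_simps(2)[OF N, of x] by auto
    have "bdd_below (N ` {x. V x = 1})"
      using vector_norm_simps(1)[OF N] by (intro bdd_belowI[of _ 0]) auto
    then have "s \<le> N ((1 / V x) *\<^sub>R x)"
      unfolding s_def by (intro cINF_lower) (use normalized[OF x] in auto)
    then show ?thesis
      using Vpos[OF x] s normalized(2)[OF x] that by (simp add: field_simps)
  qed
  then have "M \<le> 1 / s"
    unfolding M_def by (rule max_dual_norm_le[OF N V])
  then have Ms: "M * s \<le> 1"
    using s by (simp add: field_simps)
  have "R / s \<le> \<epsilon>"
    using E unfolding has_eccentricity_def R_def s_def .
  then have R: "R \<le> \<epsilon> * s"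
    using s by (simp add: field_simps)
  have "0 < R * V u"
    using upper[of u] u by linarith
  then have "0 < R"
    using Vpos[OF u0] zero_less_mult_pos2 by blast
  then have eps: "0 \<le> \<epsilon>"
    using R s by (smt (verit) mult_nonpos_nonneg)
  have "M * R \<le> M * (\<epsilon> * s)"
    using R M by (intro mult_left_mono) auto
  also have "\<dots> = \<epsilon> * (M * s)"
    by simp
  also have "\<dots> \<le> \<epsilon>"
    using mult_left_mono[OF Ms eps] by simp
  finally have MR: "M * R \<le> \<epsilon>" .
  have "M * N x \<le> M * (R * V x)"
    using upper M by (intro mult_left_mono) auto
  also have "\<dots> = M * R * V x"
    by simp
  also have "\<dots> \<le> \<epsilon> * V x"
    using MR Vpos[of x] V0 by (intro mult_right_mono) (cases "x = 0"; simp)+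
  finally show ?thesis
    by (simp add: M_def)
qed

text \<open>
  Active vectors at \<open>x\<close> are subgradients of the convex function \<open>V\<close> at \<open>x\<close>, so every difference
  quotient already satisfies the inequality.
\<close>

lemma active_inner_le_dini:
  assumes V: "defines_polyhedral_fun C V" and c: "c \<in> C" "c \<bullet> x = V x"
  shows "ereal (c \<bullet> v) \<le> dini_upper_right V x v"
  unfolding dini_upper_right_def
proof (rule le_Limsup)
  have "ereal (c \<bullet> v) \<le> ereal ((V (x + s *\<^sub>R v) - V x) / s)" if "0 < s" for s
    using polyhedral_fun_upper[OF V c(1), of "x + s *\<^sub>R v"] c(2) that
    by (simp add: inner_add_right field_simps)
  then show "\<forall>\<^sub>F s in at_right 0. ereal (c \<bullet> v) \<le> ereal ((V (x + s *\<^sub>R v) - V x) / s)"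
    by (auto simp: eventually_at_filter)
qed (rule trivial_limit_at_right_real)

section \<open>Decay of robust Lyapunov functions\<close>

lemma is_perturbation_shift:
  fixes N :: "real ^ 'd::finite \<Rightarrow> real"
  assumes N: "vector_norm N" and F: "is_pwl_system F" "\<forall>q\<in>modes F. region F q = UNIV"
    and "\<bar>r\<bar> \<le> \<gamma> * a_max N F"
  shows "is_perturbation N \<gamma> F (F\<lparr>mode_matrix := \<lambda>q. mode_matrix F q + r *\<^sub>R mat 1\<rparr>)"
  using assms unfolding is_perturbation_def is_pwl_system_def
  by (simp add: mat_norm_scaled_identity[OF N])

text \<open>
  Any perturbation that pushes \<open>y\<close> towards larger values of \<open>c\<close> would yield some decay; the shift by
  a multiple of the identity does so at all \<open>y\<close> simultaneously and turns the strict inequality of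
  the shifted system into a rate proportional to \<open>V y\<close>.
\<close>

lemma active_vector_decay:
  fixes N :: "real ^ 'd::finite \<Rightarrow> real"
  assumes N: "vector_norm N" and F: "is_pwl_system F" "\<forall>q\<in>modes F. region F q = UNIV"
    and V: "defines_polyhedral_fun C V"
    and robust: "\<forall>G. is_perturbation N \<gamma> F G \<longrightarrow> lyapunov N G V"
    and nonneg: "0 \<le> \<gamma> * a_max N F"
    and q: "q \<in> modes F" and c: "c \<in> C" "c \<bullet> y = V y" and y: "y \<noteq> 0"
  shows "c \<bullet> (mode_matrix F q *v y) < - (\<gamma> * a_max N F * V y)"
proof -
  define r where "r = \<gamma> * a_max N F"
  define G where "G = F\<lparr>mode_matrix := \<lambda>q. mode_matrix F q + r *\<^sub>R mat 1\<rparr>"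
  define v where "v = mode_matrix F q *v y + r *\<^sub>R y"
  have "lyapunov N G V"
    using robust is_perturbation_shift[OF N F, of r \<gamma>] nonneg by (simp add: G_def r_def)
  moreover have "v \<in> sys_map G y"
    unfolding sys_map_def G_def v_def using q F(2)
    by (auto simp: matrix_vector_mult_add_rdistrib scaleR_matrix_vector_assoc[symmetric]
        intro!: exI[of _ q])
  ultimately have "dini_upper_right V y v < 0"
    using y unfolding lyapunov_def by blast
  then have "c \<bullet> v < 0"
    using le_less_trans[OF active_inner_le_dini[OF V c, of v], of 0] by simp
  then show ?thesis
    using c(2) by (simp add: v_def r_def inner_add_right)
qed

section \<open>The Euler step\<close>

text \<open>
  Active vectors at the end point of the step have a controlled derivative in the direction of the
  step. The bound on \<open>\<theta>\<close> enters twice: it keeps \<open>y\<close> away from the origin, and it makes the total loss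
  at most half of the decay rate, through \<open>\<theta> a (\<epsilon> + \<gamma>) \<le> \<gamma> / 2\<close>.
\<close>

lemma active_vector_decay_after_step:
  fixes N :: "real ^ 'd::finite \<Rightarrow> real"
  assumes N: "vector_norm N"
    and A: "\<And>z. N (A *v z) \<le> a * N z"
    and M: "0 \<le> M" "\<And>z. c \<bullet> z \<le> M * N z"
    and decay: "y \<noteq> 0 \<Longrightarrow> c \<bullet> (A *v y) \<le> - (\<gamma> * a * V y)"
    and ecc: "M * N y \<le> \<epsilon> * V y"
    and pos: "0 < a" "0 < \<gamma>" "0 < \<epsilon>" "0 < \<theta>" and \<theta>: "\<theta> \<le> \<gamma> / (2 * a * (\<epsilon> + \<gamma>))"
    and y: "y = x + \<theta> *\<^sub>R (A *v x)" and x: "x \<noteq> 0"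
  shows "c \<bullet> (A *v x) \<le> - (\<gamma> * a * M * N x / (2 * \<epsilon>))"
proof -
  define T where "T = \<theta> * a"
  have "0 < 2 * a * (\<epsilon> + \<gamma>)"
    using pos by simp
  then have "\<theta> * (2 * a * (\<epsilon> + \<gamma>)) \<le> \<gamma>"
    using \<theta> by (simp only: pos_le_divide_eq)
  then have T: "0 < T" "T * (\<epsilon> + \<gamma>) \<le> \<gamma> / 2"
    using pos by (simp_all add: T_def algebra_simps)
  have "T * \<gamma> < T * (\<epsilon> + \<gamma>)"
    using T(1) pos by (intro mult_strict_left_mono) auto
  then have "T * \<gamma> < 1 * \<gamma>"
    using T(2) pos by linarith
  then have T1: "T < 1"
    using pos by (simp add: mult_less_cancel_right)
  have Nx: "0 < N x"
    using x vector_norm_simps(1,2)[OF N, of x] by linarith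
  have "N x \<le> N y + N (- (\<theta> *\<^sub>R (A *v x)))"
    using vector_norm_simps(4)[OF N, of y "- (\<theta> *\<^sub>R (A *v x))"] by (simp add: y)
  also have "\<dots> \<le> N y + T * N x"
    using mult_left_mono[OF A[of x], of \<theta>] pos by (simp add: vector_norm_simps(3,6)[OF N] T_def)
  finally have Ny: "(1 - T) * N x \<le> N y"
    by (simp add: algebra_simps)
  have "0 < (1 - T) * N x"
    using T1 Nx by simp
  then have "y \<noteq> 0"
    using Ny vector_norm_simps(2)[OF N, of 0] by force
  have "M * ((1 - T) * N x) \<le> \<epsilon> * V y"
    using mult_left_mono[OF Ny M(1)] ecc by linarith
  then have "\<gamma> * a * (M * ((1 - T) * N x)) \<le> \<gamma> * a * (\<epsilon> * V y)"
    using pos by (intro mult_left_mono) auto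
  then have end_decay: "\<epsilon> * (c \<bullet> (A *v y)) \<le> - (\<gamma> * a * M * (1 - T) * N x)"
    using mult_left_mono[OF decay[OF \<open>y \<noteq> 0\<close>], of \<epsilon>] pos by (simp add: algebra_simps)
  have Ax: "A *v x = A *v y + \<theta> *\<^sub>R (- (A *v (A *v x)))"
    by (simp add: y matrix_vector_right_distrib matrix_vector_mult_scaleR)
  have "c \<bullet> (- (A *v (A *v x))) \<le> M * N (- (A *v (A *v x)))"
    by (rule M)
  also have "\<dots> = M * N (A *v (A *v x))"
    by (simp add: vector_norm_simps(6)[OF N])
  also have "\<dots> \<le> M * (a * (a * N x))"
    using order_trans[OF A mult_left_mono[OF A, of a]] pos M(1) by (intro mult_left_mono) auto
  finally have "\<theta> * (c \<bullet> (- (A *v (A *v x)))) \<le> \<theta> * (M * (a * (a * N x)))"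
    using pos by (intro mult_left_mono) auto
  then have drift: "c \<bullet> (A *v x) \<le> c \<bullet> (A *v y) + T * (a * M * N x)"
    by (subst Ax) (simp add: inner_add_right T_def algebra_simps)
  have "\<epsilon> * (c \<bullet> (A *v x)) \<le> a * M * N x * (T * (\<epsilon> + \<gamma>) - \<gamma>)"
    using mult_left_mono[OF drift, of \<epsilon>] end_decay pos by (simp add: algebra_simps)
  also have "\<dots> \<le> a * M * N x * (- (\<gamma> / 2))"
    using T(2) pos M(1) Nx by (intro mult_left_mono) auto
  finally show ?thesis
    using pos by (simp add: field_simps)
qed

theorem theorem12:
  fixes N :: "real ^ 'd::finite \<Rightarrow> real"
    and F :: "('q, 'd) pwl_system"
    and C :: "(real ^ 'd) set"
    and V :: "real ^ 'd \<Rightarrow> real"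
    and \<epsilon> \<gamma> \<theta> \<delta> :: real
  assumes "vector_norm N"
    and "is_pwl_system F"
    and "modes F \<noteq> {}"
    and "\<forall>q\<in>modes F. region F q = UNIV"
    and "1 \<le> \<epsilon>"
    and "0 < \<gamma>"
    and "defines_polyhedral_fun C V"
    and "potential_lyapunov N V"
    and "has_eccentricity N V \<epsilon>"
    and "\<forall>G. is_perturbation N \<gamma> F G \<longrightarrow> lyapunov N G V"
    and "0 < \<theta>"
    and "\<theta> \<le> \<gamma> / (2 * a_max N F * (\<epsilon> + \<gamma>))"
    and "0 < \<delta>"
    and "\<delta> \<le> \<gamma> * a_max N F / (2 * \<epsilon>)"
  shows "\<forall>x. \<forall>v\<in>sys_map F x. \<forall>c\<in>C.
           c \<bullet> v \<le> (1 / \<theta>) * (V x - c \<bullet> x) - \<delta> * max_dual_norm N C * N x"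
proof (intro allI ballI)
  fix x v c
  assume v: "v \<in> sys_map F x" and c: "c \<in> C"
  note N = assms(1) and V = assms(7) and P = assms(8)
  define a where "a = a_max N F"
  define M where "M = max_dual_norm N C"
  obtain q where q: "q \<in> modes F" and v: "v = mode_matrix F q *v x"
    using v unfolding sys_map_def by blast
  define A where "A = mode_matrix F q"
  show "c \<bullet> v \<le> (1 / \<theta>) * (V x - c \<bullet> x) - \<delta> * max_dual_norm N C * N x"
  proof (cases "x = 0")
    case True
    have "V 0 = 0"
      using P unfolding potential_lyapunov_def by blast
    then show ?thesis
      using True by (simp add: v vector_norm_simps(5)[OF N])
  next
    case x: False
    \<comment> \<open>The case \<open>a = 0\<close> is excluded because it leaves no room for a positive \<open>\<delta>\<close>.\<close>
    have "0 < \<gamma> * a / (2 * \<epsilon>)"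
      using assms(13,14) by (simp add: a_def)
    then have a: "0 < a"
      using assms(5,6) by (simp add: zero_less_divide_iff zero_less_mult_iff)
    have "mat_norm N A \<le> a"
      using q assms(2) unfolding a_def a_max_def A_def is_pwl_system_def by simp
    then have Abound: "N (A *v z) \<le> a * N z" for z
      using vector_norm_mult_le_mat_norm[OF N, of A z]
        mult_right_mono[OF _ vector_norm_simps(1)[OF N, of z]] by (meson order_trans)
    have Nx: "0 < N x"
      using x vector_norm_simps(1,2)[OF N, of x] by linarith
    have "0 \<le> M * N x"
      using polyhedral_fun_le_max_dual_norm[OF N V, of x] P
      unfolding M_def potential_lyapunov_def by (meson order_trans)
    then have M: "0 \<le> M"
      using Nx by (simp add: zero_le_mult_iff)
    define y where "y = x + \<theta> *\<^sub>R (A *v x)"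
    obtain d where d: "d \<in> C" "d \<bullet> y = V y"
      using polyhedral_fun_active[OF V] by blast
    have "d \<bullet> (A *v x) \<le> - (\<gamma> * a * M * N x / (2 * \<epsilon>))"
    proof (rule active_vector_decay_after_step[OF N, where y = y and \<theta> = \<theta> and V = V])
      show "d \<bullet> z \<le> M * N z" for z
        unfolding M_def by (rule inner_le_max_dual_norm[OF N V d(1)])
      show "d \<bullet> (A *v y) \<le> - (\<gamma> * a * V y)" if "y \<noteq> 0"
        unfolding A_def a_def
        using active_vector_decay[OF N assms(2,4) V assms(10) _ q d that] a assms(6)
        by (simp add: a_def)
      show "M * N y \<le> \<epsilon> * V y"
        unfolding M_def by (rule eccentricity_lower_bound[OF N V P assms(9)])
    qed (use Abound M a assms(5,6,11,12) x in \<open>auto simp: a_def y_def\<close>)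
    also have "\<gamma> * a * M * N x / (2 * \<epsilon>) = \<gamma> * a / (2 * \<epsilon>) * (M * N x)"
      by simp
    finally have "d \<bullet> (A *v x) \<le> - (\<delta> * (M * N x))"
      using mult_right_mono[OF assms(14), of "M * N x"] \<open>0 \<le> M * N x\<close> by (simp add: a_def)
    then have "\<theta> * (d \<bullet> (A *v x)) \<le> \<theta> * (- (\<delta> * (M * N x)))"
      using assms(11) by (intro mult_left_mono) auto
    moreover have "V y = d \<bullet> x + \<theta> * (d \<bullet> (A *v x))"
      using d(2) by (simp add: y_def inner_add_right)
    ultimately have decrease: "V y \<le> V x - \<theta> * (\<delta> * (M * N x))"
      using polyhedral_fun_upper[OF V d(1), of x] by linarith
    have "c \<bullet> x + \<theta> * (c \<bullet> v) \<le> V y"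
      using polyhedral_fun_upper[OF V c, of y] by (simp add: y_def v A_def inner_add_right)
    then have "\<theta> * (c \<bullet> v) \<le> V x - c \<bullet> x - \<theta> * (\<delta> * (M * N x))"
      using decrease by linarith
    then show ?thesis
      using assms(11) by (simp add: M_def field_simps)
  qed
qed

end
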